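(* Let $f(x)=\sum_{k\geqslant0}a_kx^k$ with $a_k\geqslant0$, convergent for $0\leqslant x<1$, and suppose that for some $c>0$ $$\frac{f'(x)}{f(x)}\leqslant\frac{c}{1-x}\qquad(0\leqslant x<1).$$ Then there exists a positive constant $K=K(c)$ depending only on $c$ such that $$\sum_{k=0}^N a_k\geqslant K(c)\,f(e^{-1/N})\quad\text{for all } N\geqslant 2c.$$ *)

theory Defs
  imports "HOL-Analysis.Analysis"
begin

text \<open>The sum function of the power series with coefficients \<open>a\<close>. For nonnegative coefficients,
  convergence on \<open>[0, 1)\<close> gives absolute convergence on \<open>(-1, 1)\<close>, so the two-sided
  derivative \<open>deriv (power_series a) x\<close> exists at every \<open>x\<close> in \<open>[0, 1)\<close>, including \<open>x = 0\<close>.\<close>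

definition power_series :: "(nat \<Rightarrow> real) \<Rightarrow> real \<Rightarrow> real" where
  "power_series a x = (\<Sum>k. a k * x ^ k)"

end

theory Submission
  imports Defs
begin

text \<open>The hypothesis says that \<open>f x * (1 - x) powr c\<close> is nonincreasing. It also gives
  \<open>x * f' x \<le> c * x / (1 - x) * f x\<close>, while terms with \<open>k > N\<close> contribute to \<open>x * f' x\<close> at least
  \<open>N + 1\<close> times what they contribute to \<open>f x\<close>. At \<open>x = (N + 1) / (N + 1 + 2 * c)\<close>, where
  \<open>c * x / (1 - x) = (N + 1) / 2\<close>, the tail is therefore at most half of \<open>f x\<close>. Monotonicity
  transfers this from \<open>x\<close> to \<open>exp (- 1 / N)\<close>, since \<open>1 - exp (- 1 / N) \<ge> 1 / (N + 1)\<close>.\<close>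

lemma summable_diffs_unit_interval:
  fixes a :: "nat \<Rightarrow> real"
  assumes "\<And>x. 0 \<le> x \<Longrightarrow> x < 1 \<Longrightarrow> summable (\<lambda>k. a k * x ^ k)" and "0 \<le> x" "x < 1"
  shows "summable (\<lambda>k. diffs a k * x ^ k)"
proof (rule termdiff_converges[where K = 1])
  show "norm x < 1" using assms by simp
next
  fix y :: real
  assume "norm y < 1"
  \<comment> \<open>Convergence is given only at nonnegative points. Since \<open>y\<close> may be
    negative, it is taken at some \<open>r\<close> with \<open>norm y < r < 1\<close> and carried
    inside the disc.\<close>
  then obtain r where "norm y < r" "r < 1" using dense by blast
  then have "summable (\<lambda>k. a k * r ^ k)" "norm y < norm r"
    using assms(1)[of r] norm_ge_zero[of y] by (auto simp del: norm_ge_zero)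
  then show "summable (\<lambda>k. a k * y ^ k)" by (rule powser_inside)
qed

lemma power_series_has_derivative:
  assumes "\<And>x. 0 \<le> x \<Longrightarrow> x < 1 \<Longrightarrow> summable (\<lambda>k. a k * x ^ k)" and "0 \<le> x" "x < 1"
  shows "(power_series a has_real_derivative (\<Sum>k. diffs a k * x ^ k)) (at x)"
proof -
  obtain r where "x < r" "r < 1" using assms dense by blast
  then have "((\<lambda>x. \<Sum>k. a k * x ^ k) has_real_derivative (\<Sum>k. diffs a k * x ^ k)) (at x)"
    using assms by (intro termdiffs_strong[where K = r]) auto
  then show ?thesis by (simp add: power_series_def[abs_def])
qed

lemma deriv_power_series_sums:
  assumes "\<And>x. 0 \<le> x \<Longrightarrow> x < 1 \<Longrightarrow> summable (\<lambda>k. a k * x ^ k)" and "0 \<le> x" "x < 1"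
  shows "(\<lambda>k. real k * a k * x ^ k) sums (x * deriv (power_series a) x)"
proof -
  have "(\<lambda>k. x * (real k * a k * x ^ (k - Suc 0))) sums (x * (\<Sum>k. diffs a k * x ^ k))"
    by (intro sums_mult diffs_equiv summable_diffs_unit_interval assms)
  \<comment> \<open>At \<open>k = 0\<close> the exponent \<open>k - Suc 0\<close> truncates to 0,
    but the factor \<open>real k\<close> vanishes there.\<close>
  moreover have "x * (real k * a k * x ^ (k - Suc 0)) = real k * a k * x ^ k" for k
    by (cases k) auto
  ultimately show ?thesis
    using DERIV_imp_deriv[OF power_series_has_derivative[OF assms]] by simp
qed

text \<open>Termwise comparison: \<open>(N + 1 - k) * a k * x ^ k\<close> is at most
  \<open>(N + 1) * a k\<close> for \<open>k \<le> N\<close>, because \<open>x ^ k \<le> 1\<close>,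
  and is nonpositive for \<open>k > N\<close>. Bounding \<open>x ^ k\<close> by 1 brings in the
  plain partial sum of the coefficients.\<close>

lemma power_series_tail_le_deriv:
  assumes nonneg: "\<And>k. a k \<ge> 0"
    and conv: "\<And>x. 0 \<le> x \<Longrightarrow> x < 1 \<Longrightarrow> summable (\<lambda>k. a k * x ^ k)" and x: "0 \<le> x" "x < 1"
  shows "(real N + 1) * (power_series a x - (\<Sum>k = 0..N. a k)) \<le> x * deriv (power_series a) x"
proof -
  define h where "h k = (if k \<in> {0..N} then (real N + 1) * a k else 0)" for k
  have h: "h sums (\<Sum>k = 0..N. (real N + 1) * a k)"
    unfolding h_def by (rule sums_If_finite_set) simp
  have diff: "(\<lambda>k. (real N + 1) * (a k * x ^ k) - real k * a k * x ^ k) sums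
      ((real N + 1) * power_series a x - x * deriv (power_series a) x)"
    unfolding power_series_def[of a x]
    by (intro sums_diff sums_mult summable_sums conv deriv_power_series_sums x)
  have le: "(real N + 1) * (a k * x ^ k) - real k * a k * x ^ k \<le> h k" for k
  proof (cases "k \<le> N")
    case True
    have "a k * x ^ k \<le> a k * 1"
      using nonneg x by (intro mult_left_mono power_le_one) auto
    then have "(real N + 1) * (a k * x ^ k) \<le> (real N + 1) * a k"
      by (intro mult_left_mono) auto
    moreover have "0 \<le> real k * a k * x ^ k" using nonneg x by simp
    moreover have "h k = (real N + 1) * a k" using True by (simp add: h_def)
    ultimately show ?thesis by linarith
  next
    case False
    then have "real N + 1 \<le> real k" by linarith
    then have "(real N + 1) * (a k * x ^ k) \<le> real k * (a k * x ^ k)"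
      using nonneg x by (intro mult_right_mono) auto
    then show ?thesis using False by (simp add: h_def mult.assoc)
  qed
  have "(real N + 1) * power_series a x - x * deriv (power_series a) x
      \<le> (\<Sum>k = 0..N. (real N + 1) * a k)"
    by (rule sums_le[OF le diff h])
  then show ?thesis by (simp add: sum_distrib_left algebra_simps)
qed

lemma power_series_pos:
  assumes "\<And>k. a k \<ge> 0" and "summable (\<lambda>k. a k * x ^ k)" and "0 < x" and "a m \<noteq> 0"
  shows "0 < power_series a x"
proof -
  have "0 < a m" using assms(1)[of m] assms(4) by linarith
  then have "0 < a m * x ^ m" using assms(3) by simp
  then show ?thesis
    unfolding power_series_def using assms by (intro suminf_pos2[where i = m]) auto
qed

lemma power_series_mono:
  assumes "\<And>k. a k \<ge> 0" and "\<And>x. 0 \<le> x \<Longrightarrow> x < 1 \<Longrightarrow> summable (\<lambda>k. a k * x ^ k)"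
    and "0 \<le> x" "x \<le> y" "y < 1"
  shows "power_series a x \<le> power_series a y"
  unfolding power_series_def using assms
  by (intro suminf_le mult_left_mono power_mono) auto

text \<open>The derivative of \<open>f t * (1 - t) powr c\<close> factors as
  \<open>(1 - t) powr (c - 1) * (f' t * (1 - t) - c * f t)\<close>, whose second factor is
  nonpositive by hypothesis.\<close>

lemma mult_one_minus_powr_antimono:
  fixes f :: "real \<Rightarrow> real"
  assumes deriv: "\<And>t. x \<le> t \<Longrightarrow> t \<le> y \<Longrightarrow> (f has_real_derivative f' t) (at t)"
    and le: "\<And>t. x \<le> t \<Longrightarrow> t \<le> y \<Longrightarrow> f' t * (1 - t) \<le> c * f t"
    and "x \<le> y" "y < 1"
  shows "f y * (1 - y) powr c \<le> f x * (1 - x) powr c"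
proof (rule DERIV_nonpos_imp_nonincreasing[OF \<open>x \<le> y\<close>])
  fix t assume t: "x \<le> t" "t \<le> y"
  then have "t < 1" using assms by simp
  have powr: "(1 - t) powr c = (1 - t) powr (c - 1) * (1 - t)"
    using \<open>t < 1\<close> by (simp add: powr_diff)
  have "((\<lambda>t. f t * (1 - t) powr c) has_real_derivative
      f' t * (1 - t) powr c - c * (1 - t) powr (c - 1) * f t) (at t)"
    using \<open>t < 1\<close> by (auto intro!: derivative_eq_intros deriv[OF t])
  moreover have "f' t * (1 - t) powr c - c * (1 - t) powr (c - 1) * f t
      = (1 - t) powr (c - 1) * (f' t * (1 - t) - c * f t)"
    unfolding powr by (simp add: algebra_simps)
  moreover have "\<dots> \<le> 0" using le[OF t] by (intro mult_nonneg_nonpos) auto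
  ultimately show "\<exists>D. ((\<lambda>t. f t * (1 - t) powr c) has_real_derivative D) (at t) \<and> D \<le> 0"
    by (auto intro: exI[where x = "f' t * (1 - t) powr c - c * (1 - t) powr (c - 1) * f t"])
qed

text \<open>The factor 2 comes from the tail being at most half of the series at \<open>x\<close>;
  \<open>max 1 (2 * c) powr c\<close> is the cost of moving from \<open>x\<close> to
  \<open>exp (- 1 / N)\<close>.\<close>

lemma power_series_exp_le_partial_sum:
  assumes "c > 0" and nonneg: "\<And>k. a k \<ge> 0"
    and conv: "\<And>x. 0 \<le> x \<Longrightarrow> x < 1 \<Longrightarrow> summable (\<lambda>k. a k * x ^ k)"
    and growth: "\<And>x. 0 \<le> x \<Longrightarrow> x < 1 \<Longrightarrow>
      deriv (power_series a) x / power_series a x \<le> c / (1 - x)"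
    and "N > 0"
  shows "power_series a (exp (- 1 / real N)) \<le> 2 * max 1 (2 * c) powr c * (\<Sum>k = 0..N. a k)"
proof (cases "\<exists>m. a m \<noteq> 0")
  case False
  then show ?thesis by (simp add: power_series_def)
next
  case True
  then have pos: "0 < power_series a t" if "0 < t" "t < 1" for t
    using power_series_pos[of a t] nonneg conv that by auto
  \<comment> \<open>The point 0 is left out: if \<open>a 0 = 0\<close>, the quotient there is a
    division by zero, with value 0, and \<open>growth\<close> carries no information.\<close>
  have growth': "deriv (power_series a) t * (1 - t) \<le> c * power_series a t"
    if "0 < t" "t < 1" for t
    using growth[of t] pos[of t] that by (simp add: divide_simps mult.commute)
  define x where "x = (real N + 1) / (real N + 1 + 2 * c)"
  define y where "y = exp (- 1 / real N)"
  have x: "0 < x" "x < 1" and y: "0 < y" "y < 1"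
    using \<open>c > 0\<close> \<open>N > 0\<close> by (auto simp: x_def y_def)
  have one_minus_x: "1 - x = 2 * c / (real N + 1 + 2 * c)"
    using \<open>c > 0\<close> by (simp add: x_def field_simps)
  have x_eq: "x * c = (1 - x) * ((real N + 1) / 2)"
    unfolding one_minus_x by (simp add: x_def mult.commute)
  have "1 + 1 / real N \<le> exp (1 / real N)" by (rule exp_ge_add_one_self)
  then have "y \<le> inverse (1 + 1 / real N)"
    unfolding y_def using \<open>N > 0\<close>
    by (simp add: exp_minus le_imp_inverse_le add_pos_nonneg)
  also have "\<dots> = 1 - 1 / (real N + 1)" using \<open>N > 0\<close> by (simp add: field_simps)
  finally have one_minus_y: "1 / (real N + 1) \<le> 1 - y" by simp
  have "1 - x \<le> 2 * c * (1 / (real N + 1))"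
    unfolding one_minus_x using \<open>c > 0\<close> by (simp add: frac_le)
  also have "\<dots> \<le> 2 * c * (1 - y)"
    using one_minus_y \<open>c > 0\<close> by (intro mult_left_mono) auto
  \<comment> \<open>Raising \<open>2 * c\<close> to at least 1 makes its power at least 1, which the
    case \<open>y < x\<close> below relies on.\<close>
  also have "\<dots> \<le> max 1 (2 * c) * (1 - y)" using y by (intro mult_right_mono) auto
  finally have ratio: "1 - x \<le> max 1 (2 * c) * (1 - y)" .

  have "x * deriv (power_series a) x \<le> (real N + 1) / 2 * power_series a x"
  proof -
    have "x * (deriv (power_series a) x * (1 - x)) \<le> x * (c * power_series a x)"
      using growth' x by (intro mult_left_mono) auto
    also have "\<dots> = (1 - x) * ((real N + 1) / 2 * power_series a x)"
      by (simp only: x_eq flip: mult.assoc)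
    finally have "(1 - x) * (x * deriv (power_series a) x)
        \<le> (1 - x) * ((real N + 1) / 2 * power_series a x)"
      by (simp add: mult_ac)
    then show ?thesis using x by simp
  qed
  \<comment> \<open>With \<open>S\<close> the partial sum and \<open>f\<close> the value at
    \<open>x\<close>, \<open>(N + 1) * (f - S) \<le> (N + 1) / 2 * f\<close> rearranges to
    \<open>f \<le> 2 * S\<close>.\<close>
  with power_series_tail_le_deriv[OF nonneg conv, of x N] x
  have "(real N + 1) * power_series a x \<le> (real N + 1) * (2 * (\<Sum>k = 0..N. a k))"
    by (simp add: algebra_simps)
  then have half: "power_series a x \<le> 2 * (\<Sum>k = 0..N. a k)"
    by simp

  have "power_series a y \<le> max 1 (2 * c) powr c * power_series a x"
  proof (cases "x \<le> y")
    case False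
    then have "power_series a y \<le> 1 * power_series a x"
      using power_series_mono[OF nonneg conv, of y x] x y by simp
    also have "\<dots> \<le> max 1 (2 * c) powr c * power_series a x"
      using \<open>c > 0\<close> pos[OF x] by (intro mult_right_mono ge_one_powr_ge_zero) auto
    finally show ?thesis .
  next
    case True
    \<comment> \<open>On \<open>[x, y]\<close> every \<open>t\<close> is positive, so
      \<open>growth'\<close> applies. The loss is \<open>((1 - x) / (1 - y)) powr c\<close>, bounded
      through \<open>ratio\<close> independently of \<open>N\<close>.\<close>
    have "power_series a y * (1 - y) powr c \<le> power_series a x * (1 - x) powr c"
    proof (rule mult_one_minus_powr_antimono[OF _ _ True \<open>y < 1\<close>])
      fix t assume t: "x \<le> t" "t \<le> y"
      then show "(power_series a has_real_derivative deriv (power_series a) t) (at t)"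
        using power_series_has_derivative[OF conv, of t] x y
        by (auto simp: DERIV_imp_deriv)
      show "deriv (power_series a) t * (1 - t) \<le> c * power_series a t"
        using growth' t x y by simp
    qed
    also have "\<dots> \<le> power_series a x * (max 1 (2 * c) * (1 - y)) powr c"
      using ratio x \<open>c > 0\<close> pos[OF x] by (intro mult_left_mono powr_mono2) auto
    also have "\<dots> = (max 1 (2 * c) powr c * power_series a x) * (1 - y) powr c"
      using y by (simp add: powr_mult)
    finally show ?thesis using y by simp
  qed
  also have "\<dots> \<le> max 1 (2 * c) powr c * (2 * (\<Sum>k = 0..N. a k))"
    using half by (intro mult_left_mono) auto
  finally show ?thesis by (simp add: y_def mult_ac)
qed

theorem theorem11:
  fixes c :: real
  assumes "c > 0"
  shows "\<exists>K::real. K > 0 \<and>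
    (\<forall>a :: nat \<Rightarrow> real.
       (\<forall>k. a k \<ge> 0) \<longrightarrow>
       (\<forall>x::real. 0 \<le> x \<and> x < 1 \<longrightarrow> summable (\<lambda>k. a k * x ^ k)) \<longrightarrow>
       (\<forall>x::real. 0 \<le> x \<and> x < 1 \<longrightarrow>
          deriv (power_series a) x / power_series a x \<le> c / (1 - x)) \<longrightarrow>
       (\<forall>N::nat. real N \<ge> 2 * c \<longrightarrow>
          (\<Sum>k = 0..N. a k) \<ge> K * power_series a (exp (- 1 / real N))))"
proof -
  \<comment> \<open>\<open>M\<close> is fixed before \<open>a\<close> and \<open>N\<close>, so
    \<open>1 / M\<close> depends on \<open>c\<close> alone.\<close>
  define M where "M = 2 * max 1 (2 * c) powr c"
  have "M > 0" by (simp add: M_def)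
  show ?thesis
  proof (intro exI[of _ "1 / M"] conjI allI impI)
    show "1 / M > 0" using \<open>M > 0\<close> by simp
  next
    fix a :: "nat \<Rightarrow> real" and N :: nat
    assume *: "\<forall>k. a k \<ge> 0" "\<forall>x::real. 0 \<le> x \<and> x < 1 \<longrightarrow> summable (\<lambda>k. a k * x ^ k)"
      "\<forall>x::real. 0 \<le> x \<and> x < 1 \<longrightarrow> deriv (power_series a) x / power_series a x \<le> c / (1 - x)"
      and "real N \<ge> 2 * c"
    then have "N > 0" using assms by (cases N) auto
    then have "power_series a (exp (- 1 / real N)) \<le> M * (\<Sum>k = 0..N. a k)"
      unfolding M_def using * assms by (intro power_series_exp_le_partial_sum) auto
    then show "(\<Sum>k = 0..N. a k) \<ge> 1 / M * power_series a (exp (- 1 / real N))"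
      using \<open>M > 0\<close> by (simp add: field_simps)
  qed
qed

end
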